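(* Let $a\in\mathbb{Z}$ and let $f(x)\in\mathbb{Z}[[x]]$ be the formal power series defined by $$f(x)=\frac{1}{1-(a-1)x-xf(x)}.$$ Then the Riordan array $(f(x),x)$ is invariant under the $(a)$-process; that is, applying the $(a)$-process to the infinite matrix $(f(x),x)$ returns the matrix $(f(x),x)$ itself.
   Context: All matrices are infinite, integer-valued, lower-triangular, with rows and columns indexed by $1,2,3,\dots$ in the definition of the process. The $(a)$-process: let $M=(m_{i,j})_{i,j\ge 1}$ be a lower-triangular matrix with $1$'s on the diagonal. Form the lower-triangular matrix $\tilde M_a$ whose $(i,j)$ entry is: $1$ if $i=j$; $-a$ if $i=j+1$; $-m_{i-1,j}$ if $i\ge j+2$; and $0$ if $i<j$. The output of the $(a)$-process applied to $M$ is the inverse matrix $\tilde M_a^{-1}$. Riordan array: for power series $g(x)=1+g_1x+\cdots$ and $h(x)=h_1x+h_2x^2+\cdots$ with $h_1\neq 0$, $(g(x),h(x))$ denotes the infinite lower-triangular matrix whose $i$-th column (first column indexed by $0$) has generating function $g(x)h(x)^i$. In particular, if $f(x)=\sum_{n\ge0}a_nx^n$, then $(f(x),x)$ is the matrix with $(i,j)$ entry $a_{i-j}$ for $i\ge j$ and $0$ for $i<j$. The equation defining $f$ determines a unique formal power series, with constant term $1$. *)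

theory Defs
  imports "HOL-Computational_Algebra.Formal_Power_Series"
begin

text \<open>Infinite matrices are functions of a row and a column index, both starting at 0.
  Whether the indices of the process start at 0 or at 1 is immaterial, since its defining
  formula only compares and subtracts indices.\<close>

type_synonym imat = "nat \<Rightarrow> nat \<Rightarrow> int"

definition lower_triangular :: "imat \<Rightarrow> bool" where
  "lower_triangular A \<longleftrightarrow> (\<forall>i j. i < j \<longrightarrow> A i j = 0)"

definition id_imat :: imat where
  "id_imat i j = (if i = j then 1 else 0)"

text \<open>For lower-triangular \<open>A\<close> the entries \<open>A i k\<close> with \<open>k > i\<close> vanish, so this
  finite sum is the full matrix product.\<close>

definition lt_mult :: "imat \<Rightarrow> imat \<Rightarrow> imat" where
  "lt_mult A B i j = (\<Sum>k\<le>i. A i k * B k j)"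

definition is_lt_inverse :: "imat \<Rightarrow> imat \<Rightarrow> bool" where
  "is_lt_inverse A B \<longleftrightarrow>
     lower_triangular B \<and> lt_mult A B = id_imat \<and> lt_mult B A = id_imat"

definition lt_inverse :: "imat \<Rightarrow> imat" where
  "lt_inverse A = (THE B. is_lt_inverse A B)"

definition tilde :: "int \<Rightarrow> imat \<Rightarrow> imat" where
  "tilde a M i j =
     (if i = j then 1
      else if i = j + 1 then - a
      else if i \<ge> j + 2 then - M (i - 1) j
      else 0)"

definition a_process :: "int \<Rightarrow> imat \<Rightarrow> imat" where
  "a_process a M = lt_inverse (tilde a M)"

definition riordan :: "int fps \<Rightarrow> int fps \<Rightarrow> imat" where
  "riordan g h i j = fps_nth (g * h ^ j) i"

text \<open>The inverse in the process always exists and is unique.\<close>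

lemma lt_mult_assoc:
  assumes "lower_triangular A" "lower_triangular B"
  shows "lt_mult (lt_mult A B) C = lt_mult A (lt_mult B C)"
proof (intro ext)
  fix i j
  have "lt_mult A (lt_mult B C) i j = (\<Sum>l\<le>i. A i l * (\<Sum>k\<le>i. B l k * C k j))"
    unfolding lt_mult_def
  proof (intro sum.cong refl)
    fix l assume "l \<in> {..i}"
    then have "(\<Sum>k\<le>l. B l k * C k j) = (\<Sum>k\<le>i. B l k * C k j)"
      using assms(2) by (intro sum.mono_neutral_left) (auto simp: lower_triangular_def)
    then show "A i l * (\<Sum>k\<le>l. B l k * C k j) = A i l * (\<Sum>k\<le>i. B l k * C k j)" by simp
  qed
  also have "\<dots> = (\<Sum>l\<le>i. \<Sum>k\<le>i. A i l * B l k * C k j)"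
    by (simp add: sum_distrib_left mult.assoc)
  also have "\<dots> = (\<Sum>k\<le>i. \<Sum>l\<le>i. A i l * B l k * C k j)"
    by (rule sum.swap)
  also have "\<dots> = lt_mult (lt_mult A B) C i j"
    by (simp add: lt_mult_def sum_distrib_right)
  finally show "lt_mult (lt_mult A B) C i j = lt_mult A (lt_mult B C) i j" by simp
qed

lemma lt_mult_id_left: "lt_mult id_imat A = A"
  by (intro ext) (simp add: lt_mult_def id_imat_def if_distrib[of "\<lambda>x. x * _"] cong: if_cong)

lemma lt_mult_id_right:
  assumes "lower_triangular A"
  shows "lt_mult A id_imat = A"
proof (intro ext)
  fix i j
  have "lt_mult A id_imat i j = (\<Sum>k\<le>i. if k = j then A i k else 0)"
    unfolding lt_mult_def id_imat_def by (intro sum.cong) auto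
  also have "\<dots> = A i j"
    using assms by (auto simp: lower_triangular_def)
  finally show "lt_mult A id_imat i j = A i j" .
qed

lemma is_lt_inverse_unique:
  assumes "lower_triangular A" "is_lt_inverse A B" "is_lt_inverse A C"
  shows "B = C"
  using assms lt_mult_assoc[of B A C] lt_mult_id_left[of C] lt_mult_id_right[of B]
  by (simp add: is_lt_inverse_def)

fun right_inv :: "imat \<Rightarrow> nat \<Rightarrow> nat \<Rightarrow> int" where
  "right_inv A i j =
     (if i < j then 0 else if i = j then 1 else - (\<Sum>k\<in>{..<i}. A i k * right_inv A k j))"

declare right_inv.simps [simp del]

lemma right_inv_lower: "lower_triangular (right_inv A)"
  unfolding lower_triangular_def by (auto simp: right_inv.simps[of A])

lemma right_inv_diag: "right_inv A i i = 1"
  by (simp add: right_inv.simps[of A])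

lemma right_inv_mult:
  assumes "\<And>i. A i i = 1"
  shows "lt_mult A (right_inv A) = id_imat"
proof (intro ext)
  fix i j
  have split: "lt_mult A (right_inv A) i j =
      right_inv A i j + (\<Sum>k<i. A i k * right_inv A k j)"
    using assms by (simp add: lt_mult_def lessThan_Suc_atMost[symmetric])
  have zero: "(\<Sum>k<i. A i k * right_inv A k j) = 0" if "i \<le> j"
    using that right_inv_lower[of A] by (intro sum.neutral) (auto simp: lower_triangular_def)
  consider "i < j" | "i = j" | "j < i" by linarith
  then show "lt_mult A (right_inv A) i j = id_imat i j"
  proof cases
    case 3
    then show ?thesis
      unfolding split by (simp add: right_inv.simps[of A i j] id_imat_def)
  qed (use split zero right_inv_lower[of A] right_inv_diag[of A] in
      \<open>auto simp: lower_triangular_def id_imat_def\<close>)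
qed

lemma ex1_lt_inverse:
  assumes "lower_triangular A" "\<And>i. A i i = 1"
  shows "\<exists>!B. is_lt_inverse A B"
proof -
  let ?B = "right_inv A"
  let ?C = "right_inv ?B"
  have AB: "lt_mult A ?B = id_imat" and BC: "lt_mult ?B ?C = id_imat"
    using assms(2) right_inv_diag by (simp_all add: right_inv_mult)
  have "A = ?C"
    using lt_mult_assoc[of A ?B ?C] assms(1) right_inv_lower AB BC
      lt_mult_id_left[of ?C] lt_mult_id_right[of A] by simp
  with AB BC right_inv_lower have "is_lt_inverse A ?B"
    by (simp add: is_lt_inverse_def)
  with is_lt_inverse_unique[OF assms(1)] show ?thesis by blast
qed

lemma is_lt_inverse_a_process: "is_lt_inverse (tilde a M) (a_process a M)"
  unfolding a_process_def lt_inverse_def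
  by (rule theI'[of "is_lt_inverse (tilde a M)"], rule ex1_lt_inverse)
    (auto simp: lower_triangular_def tilde_def)

lemma riordan_fps_X: "riordan f fps_X i j = (if j \<le> i then fps_nth f (i - j) else 0)"
  by (simp add: riordan_def fps_X_power_mult_right_nth)

text \<open>The functional equation \<open>f = 1 / (1 - (a - 1) x - x f)\<close> has exactly one solution over
  the integers; there the reciprocal is the multiplicative inverse in the ring of power series.\<close>

fun fcoeff :: "int \<Rightarrow> nat \<Rightarrow> int" where
  "fcoeff a 0 = 1"
| "fcoeff a (Suc n) = (a - 1) * fcoeff a n + (\<Sum>k\<in>{..n}. fcoeff a k * fcoeff a (n - k))"

lemma all_nat_cases: "(\<forall>n. P n) \<longleftrightarrow> P 0 \<and> (\<forall>n. P (Suc n))"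
  by (metis not0_implies_Suc)

lemma functional_equation_iff:
  fixes f :: "int fps"
  shows "f * (1 - fps_const (a - 1) * fps_X - fps_X * f) = 1 \<longleftrightarrow>
    fps_nth f 0 = 1 \<and>
    (\<forall>n. fps_nth f (Suc n) =
       (a - 1) * fps_nth f n + (\<Sum>k\<le>n. fps_nth f k * fps_nth f (n - k)))"
proof -
  have "f * (1 - fps_const (a - 1) * fps_X - fps_X * f) - 1 =
      f - (1 + fps_X * (fps_const (a - 1) * f + f * f))"
    by (simp only: algebra_simps mult_1_right mult_1_left)
  then have "f * (1 - fps_const (a - 1) * fps_X - fps_X * f) = 1 \<longleftrightarrow>
      f = 1 + fps_X * (fps_const (a - 1) * f + f * f)"
    by (metis right_minus_eq)
  also have "\<dots> \<longleftrightarrow> (\<forall>n. fps_nth f n =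
      fps_nth (1 + fps_X * (fps_const (a - 1) * f + f * f)) n)"
    by (rule fps_eq_iff)
  also have "\<dots> \<longleftrightarrow> fps_nth f 0 = 1 \<and>
    (\<forall>n. fps_nth f (Suc n) =
       (a - 1) * fps_nth f n + (\<Sum>k\<le>n. fps_nth f k * fps_nth f (n - k)))"
    by (subst all_nat_cases) (simp add: fps_mult_nth[of f f] atLeast0AtMost)
  finally show ?thesis .
qed

lemma ex1_functional_equation:
  "\<exists>!f :: int fps. f * (1 - fps_const (a - 1) * fps_X - fps_X * f) = 1"
  unfolding functional_equation_iff
proof (rule ex1I[of _ "Abs_fps (fcoeff a)"])
  fix f :: "int fps"
  assume f: "fps_nth f 0 = 1 \<and>
    (\<forall>n. fps_nth f (Suc n) =
       (a - 1) * fps_nth f n + (\<Sum>k\<le>n. fps_nth f k * fps_nth f (n - k)))"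
  have "fps_nth f n = fcoeff a n" for n
  proof (induction n rule: less_induct)
    case (less n)
    then show ?case using f by (cases n) auto
  qed
  then show "f = Abs_fps (fcoeff a)" by (simp add: fps_eq_iff)
qed simp

end

theory Submission
  imports Defs
begin

text \<open>The matrices \<open>(g(x), x)\<close> multiply like the power series \<open>g\<close>, and
  \<open>f\<^sub>0 = 1\<close> makes the matrix inverted in the process equal to
  \<open>(1 - (a - 1) x - x f(x), x)\<close>. The functional equation says that this has inverse
  \<open>(f(x), x)\<close>.\<close>

lemma lower_triangular_riordan_fps_X: "lower_triangular (riordan g fps_X)"
  by (simp add: lower_triangular_def riordan_fps_X)

text \<open>The left factor is constant along diagonals, so it acts on each column as convolution
  with \<open>g\<close>.\<close>

lemma lt_mult_riordan_fps_X: "lt_mult (riordan g fps_X) (riordan h l) = riordan (g * h) l"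
proof (intro ext)
  fix i j
  \<comment> \<open>With \<open>g\<close> as the last factor, the Cauchy sum runs over the same
    index \<open>k\<close> as the matrix product.\<close>
  have "riordan (g * h) l i j = fps_nth ((h * l ^ j) * g) i"
    by (simp add: riordan_def mult_ac)
  also have "\<dots> = (\<Sum>k\<le>i. fps_nth (h * l ^ j) k * fps_nth g (i - k))"
    by (simp add: fps_mult_nth[of "h * l ^ j"] atLeast0AtMost)
  also have "\<dots> = lt_mult (riordan g fps_X) (riordan h l) i j"
    unfolding lt_mult_def
    by (intro sum.cong) (auto simp: riordan_fps_X riordan_def[of h l])
  finally show "lt_mult (riordan g fps_X) (riordan h l) i j = riordan (g * h) l i j" ..
qed

lemma riordan_1_fps_X: "riordan 1 fps_X = id_imat"
  by (intro ext) (simp add: riordan_fps_X id_imat_def)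

lemma is_lt_inverse_riordan_fps_X:
  assumes "g * h = 1"
  shows "is_lt_inverse (riordan g fps_X) (riordan h fps_X)"
  using assms
  by (simp add: is_lt_inverse_def lower_triangular_riordan_fps_X lt_mult_riordan_fps_X
      riordan_1_fps_X mult.commute[of h])

text \<open>The subdiagonal matches because the coefficient of x is -(a - 1) - f_0 = -a. Below it,
  the row shift \<open>i - 1\<close> in \<open>tilde\<close> is the factor x in x f(x).\<close>

lemma tilde_riordan_fps_X:
  assumes "fps_nth f 0 = 1"
  shows "tilde a (riordan f fps_X) =
    riordan (1 - fps_const (a - 1) * fps_X - fps_X * f) fps_X"
proof (intro ext)
  fix i j
  consider "i < j" | "i = j" | "i = j + 1" | n where "i = j + Suc (Suc n)"
    by (metis add_Suc_right add_cancel_right_right less_imp_Suc_add linorder_neqE_nat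
        not0_implies_Suc Suc_eq_plus1)
  then show "tilde a (riordan f fps_X) i j =
      riordan (1 - fps_const (a - 1) * fps_X - fps_X * f) fps_X i j"
    by cases (simp_all add: tilde_def riordan_fps_X assms)
qed

theorem proposition9:
  fixes a :: int and f :: "int fps"
  assumes "f * (1 - fps_const (a - 1) * fps_X - fps_X * f) = 1"
  shows "a_process a (riordan f fps_X) = riordan f fps_X"
proof -
  let ?d = "1 - fps_const (a - 1) * fps_X - fps_X * f"
  have "fps_nth f 0 = 1"
    using assms by (simp add: functional_equation_iff)
  then have tilde: "tilde a (riordan f fps_X) = riordan ?d fps_X"
    by (rule tilde_riordan_fps_X)
  have "is_lt_inverse (riordan ?d fps_X) (riordan f fps_X)"
    using assms by (intro is_lt_inverse_riordan_fps_X) (simp add: mult.commute)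
  \<comment> \<open>The output of the process and \<open>riordan f fps_X\<close> both invert the
    same lower-triangular matrix, hence agree.\<close>
  then show ?thesis
    using is_lt_inverse_a_process[of a "riordan f fps_X"] is_lt_inverse_unique
      lower_triangular_riordan_fps_X
    unfolding tilde by blast
qed

end
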